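(* Let $\lambda_1,\lambda_2\in\mathbb{R}$ satisfy $0<|\lambda_1|<|\lambda_2|<1$, let $\Lambda:=\mathrm{diag}(\lambda_1,\lambda_2)$, $\alpha_0:=1-\log|\lambda_2|/\log|\lambda_1|$, and let $\alpha\in(0,\alpha_0]$. Let $F:\mathbb{R}^2\to\mathbb{R}^2$ be a $C^{1,\alpha}$ diffeomorphism such that $F(O)=O$ and $DF(O)=\Lambda$, where $O$ is the origin. Then there exists a homeomorphism $\Phi$ from a neighborhood of $O$ onto its image such that $\Phi\circ F=\Lambda\circ\Phi$ near $O$, $\Phi(O)=O$, and both $\Phi$ and its inverse $\Phi^{-1}$ are differentiable at $O$ with $D\Phi(O)=D\Phi^{-1}(O)=\mathrm{id}$.
   Context: A mapping $F$ is $C^{1,\alpha}$ ($\alpha\in(0,1]$) if it is $C^1$ and $\sup_{x\ne y}\|DF(x)-DF(y)\|/\|x-y\|^{\alpha}<\infty$. $\mathrm{id}$ denotes the identity mapping of $\mathbb{R}^2$. All linearization results are local, near $O$. *)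

theory Defs
  imports "HOL-Analysis.Analysis"
begin

definition C1_map :: "('a::real_normed_vector \<Rightarrow> 'b::real_normed_vector) \<Rightarrow> bool" where
  "C1_map F \<longleftrightarrow>
    (\<exists>DF :: 'a \<Rightarrow> 'a \<Rightarrow>\<^sub>L 'b.
      (\<forall>x. (F has_derivative blinfun_apply (DF x)) (at x)) \<and> continuous_on UNIV DF)"

text \<open>The norm of \<open>DF x - DF y\<close> below is the operator norm. The Hoelder condition is global.\<close>

definition C1_Hoelder :: "real \<Rightarrow> ('a::real_normed_vector \<Rightarrow> 'b::real_normed_vector) \<Rightarrow> bool" where
  "C1_Hoelder \<alpha> F \<longleftrightarrow>
    (\<exists>DF :: 'a \<Rightarrow> 'a \<Rightarrow>\<^sub>L 'b.
      (\<forall>x. (F has_derivative blinfun_apply (DF x)) (at x)) \<and> continuous_on UNIV DF \<and>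
      bdd_above {norm (DF x - DF y) / norm (x - y) powr \<alpha> | x y. x \<noteq> y})"

definition C1_diffeo :: "('a::real_normed_vector \<Rightarrow> 'b::real_normed_vector) \<Rightarrow> bool" where
  "C1_diffeo F \<longleftrightarrow> bij F \<and> C1_map F \<and> C1_map (inv F)"

text \<open>A \<open>C\<^sup>1\<close> diffeomorphism which is a \<open>C1_Hoelder\<close> mapping. No global Hoelder bound is
  imposed on the derivative of the inverse.\<close>

definition C1_Hoelder_diffeo ::
    "real \<Rightarrow> ('a::real_normed_vector \<Rightarrow> 'b::real_normed_vector) \<Rightarrow> bool" where
  "C1_Hoelder_diffeo \<alpha> F \<longleftrightarrow> C1_diffeo F \<and> C1_Hoelder \<alpha> F"

definition diag2 :: "real \<Rightarrow> real \<Rightarrow> real^2^2" where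
  "diag2 a b = vector [vector [a, 0], vector [0, b]]"

end

theory Submission
  imports Defs
begin

text \<open>Write \<open>F = \<Lambda> + f\<close>. Since \<open>D f 0 = 0\<close>, on a ball of small radius \<open>F\<close> contracts by some \<open>\<rho>\<close> slightly
  larger than \<open>\<bar>lam2\<bar>\<close>, so small that \<open>\<rho> powr (1 + \<alpha>) < \<bar>lam2\<bar>\<close>. Hence the second components of
  \<open>F\<^sup>n x / lam2 ^ n\<close> converge to a weak coordinate \<open>\<phi>\<close> with \<open>\<phi> \<circ> F = lam2 * \<phi>\<close>, and \<open>F\<close> becomes a skew product over
  \<open>u \<mapsto> lam2 * u\<close>. The hypothesis on \<open>\<alpha>\<close> gives \<open>\<bar>lam1\<bar> < \<bar>lam2\<bar> powr (1 + \<alpha>)\<close>, which makes the graph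
  transform contract in a weighted norm, so there is a continuous invariant graph
  \<open>x $ 1 = h (\<phi> x)\<close> with \<open>h u = O(\<bar>u\<bar> powr (1 + \<alpha>))\<close>. Two points on the same fibre of \<open>\<phi>\<close> approach each other
  at the exact rate \<open>lam1\<close>, up to a convergent product of factors \<open>1 + O(\<bar>F\<^sup>n x\<bar> powr \<alpha>)\<close>; therefore the quotients
  \<open>(F\<^sup>n x $ 1 - h (\<phi> (F\<^sup>n x))) / lam1 ^ n\<close> converge to a strong coordinate \<open>\<psi>\<close>, which is injective on fibres.
  The map \<open>(\<psi>, \<phi>)\<close> is continuous, injective and tangent to the identity at \<open>0\<close>, and invariance of domain
  makes it a local homeomorphism.\<close>

section \<open>Geometric limits, perturbed identities and invariant graphs\<close>

text \<open>Telescoping identifies \<open>a n - a 0\<close> with the partial sums of a series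
  dominated by a geometric one, and the second bound is the tail of that series. The case
  \<open>n = 0\<close> compares the limit with the starting term; general \<open>n\<close> gives
  rates of convergence.\<close>

lemma geometric_increments_limit:
  fixes a :: "nat \<Rightarrow> 'a::banach"
  assumes step: "\<And>n. norm (a (Suc n) - a n) \<le> c * q ^ n" and q: "0 \<le> q" "q < 1"
  obtains l where "a \<longlonglongrightarrow> l" "\<And>n. norm (l - a n) \<le> c * q ^ n / (1 - q)"
proof -
  define d where "d = (\<lambda>n. a (Suc n) - a n)"
  have sg: "summable (\<lambda>k. c * q ^ k)"
    using q by (intro summable_mult summable_geometric) simp
  have sd: "summable d"
    by (rule summable_comparison_test'[OF sg, of 0]) (use step d_def in auto)
  have tele: "(\<Sum>k<n. d k) = a n - a 0" for n
    unfolding d_def by (rule sum_lessThan_telescope)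
  have "(\<lambda>n. a n - a 0) \<longlonglongrightarrow> suminf d"
    using summable_LIMSEQ[OF sd] by (simp add: tele)
  from tendsto_add[OF this tendsto_const[of "a 0"]]
  have lim: "a \<longlonglongrightarrow> suminf d + a 0" by simp
  have "norm (suminf d + a 0 - a n) \<le> c * q ^ n / (1 - q)" for n
  proof -
    have s: "summable (\<lambda>k. c * q ^ (k + n))"
      using summable_ignore_initial_segment[OF sg] by simp
    have "suminf d = (\<Sum>k. d (k + n)) + (a n - a 0)"
      using suminf_split_initial_segment[OF sd, of n] by (simp add: tele)
    then have "suminf d + a 0 - a n = (\<Sum>k. d (k + n))" by simp
    also have "norm \<dots> \<le> (\<Sum>k. c * q ^ (k + n))"
      using step by (intro norm_suminf_le[OF _ s]) (auto simp: d_def)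
    also have "\<dots> = (\<Sum>k. (c * q ^ n) * q ^ k)" by (simp add: power_add ac_simps)
    also have "\<dots> = c * q ^ n * (\<Sum>k. q ^ k)"
      using q by (intro suminf_mult summable_geometric) simp
    also have "\<dots> = c * q ^ n / (1 - q)"
      using q by (simp add: suminf_geometric)
    finally show ?thesis .
  qed
  with lim show ?thesis by (rule that)
qed

lemma continuous_on_geometric_limit:
  fixes a :: "nat \<Rightarrow> 'a::topological_space \<Rightarrow> 'b::real_normed_vector"
  assumes cont: "\<And>n. continuous_on A (a n)"
    and bound: "\<And>n x. x \<in> A \<Longrightarrow> norm (l x - a n x) \<le> c * q ^ n" and q: "0 \<le> q" "q < 1"
  shows "continuous_on A l"
proof (rule uniform_limit_theorem)
  show "uniform_limit A a l sequentially"
  proof (rule uniform_limitI)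
    fix e :: real assume "0 < e"
    have "(\<lambda>n. c * q ^ n) \<longlonglongrightarrow> c * 0"
      using q by (intro tendsto_mult tendsto_const LIMSEQ_power_zero) simp
    then have "\<forall>\<^sub>F n in sequentially. c * q ^ n < e"
      using \<open>0 < e\<close> by (simp add: order_tendstoD)
    then show "\<forall>\<^sub>F n in sequentially. \<forall>x\<in>A. dist (a n x) (l x) < e"
      by eventually_elim (metis bound dist_norm dist_commute order_le_less_trans)
  qed
qed (use cont in auto)

text \<open>\<open>q y\<close> is the fixed point of \<open>x \<mapsto> y - p x\<close>, a
  contraction with factor 1/2. Absorbing half of the distance of the images yields the Lipschitz
  constant 2.\<close>

lemma perturbed_identity_inverse:
  fixes p :: "'a::banach \<Rightarrow> 'a"
  assumes p: "\<And>x y. norm (p x - p y) \<le> 1 / 2 * norm (x - y)"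
  obtains q where "\<And>y. q y + p (q y) = y" "\<And>x. q (x + p x) = x"
    "\<And>y z. norm (q y - q z) \<le> 2 * norm (y - z)"
proof -
  have ex: "\<exists>!x. y - p x = x" for y
    by (rule banach_fix_type[of "1/2"]) (use p in \<open>auto simp: dist_norm norm_minus_commute\<close>)
  define q where "q = (\<lambda>y. THE x. y - p x = x)"
  have "y - p (q y) = q y" for y
    unfolding q_def by (rule theI'[OF ex])
  then have q1: "q y + p (q y) = y" for y
    by (metis diff_add_cancel)
  have q2: "q (x + p x) = x" for x
    unfolding q_def by (rule the1_equality[OF ex]) simp
  have "norm (q y - q z) \<le> 2 * norm (y - z)" for y z
  proof -
    have "q y - q z = (y - z) - (p (q y) - p (q z))"
      using q1[of y] q1[of z] by (simp add: algebra_simps)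
    then have "norm (q y - q z) \<le> norm (y - z) + norm (p (q y) - p (q z))"
      by (metis norm_triangle_ineq4)
    with p[of "q y" "q z"] show ?thesis by linarith
  qed
  with q1 q2 show ?thesis by (rule that)
qed

text \<open>Precomposition with this map turns estimates on a ball into global ones. The
  nearest-point projection is nonexpansive and fixes 0, which also gives the bound by
  \<open>norm x\<close>.\<close>

lemma cball_retraction:
  fixes r :: real
  assumes "0 < r"
  obtains c :: "'a::euclidean_space \<Rightarrow> 'a"
  where "\<And>x. norm (c x) \<le> r" "\<And>x. norm (c x) \<le> norm x"
    "\<And>x y. norm (c x - c y) \<le> norm (x - y)" "\<And>x. norm x \<le> r \<Longrightarrow> c x = x"
proof -
  let ?c = "closest_point (cball (0::'a) r)"
  have lip: "norm (?c x - ?c y) \<le> norm (x - y)" for x y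
    using closest_point_lipschitz[of "cball 0 r" x y] assms by (simp add: dist_norm)
  have self: "norm x \<le> r \<Longrightarrow> ?c x = x" for x
    by (rule closest_point_self) simp
  have "?c x \<in> cball 0 r" for x
    using assms by (intro closest_point_in_set) auto
  moreover have "norm (?c x) \<le> norm x" for x
    using lip[of x 0] self[of 0] assms by simp
  ultimately show ?thesis using lip self by (intro that[of ?c]) auto
qed

text \<open>The graph of \<open>h\<close> is obtained by iterating the graph transform on the zero function. The weight
  \<open>\<bar>u\<bar> powr \<beta>\<close> compensates the dilation \<open>u \<mapsto> u / l\<close>.\<close>

lemma invariant_graph:
  fixes S :: "real \<Rightarrow> real \<Rightarrow> real"
  assumes lip: "\<And>a b u. \<bar>S a u - S b u\<bar> \<le> \<kappa> * \<bar>a - b\<bar>"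
    and S0: "\<And>u. \<bar>S 0 u\<bar> \<le> K * \<bar>u\<bar> powr \<beta>"
    and contS: "continuous_on UNIV (\<lambda>(a, u). S a u)"
    and \<kappa>: "0 \<le> \<kappa>" "\<kappa> < \<bar>l\<bar> powr \<beta>" and l: "l \<noteq> 0" and \<beta>: "0 < \<beta>" and K: "0 \<le> K"
  obtains h K' where "continuous_on UNIV h" "\<And>u. h (l * u) = S (h u) u"
    "\<And>u. \<bar>h u\<bar> \<le> K' * \<bar>u\<bar> powr \<beta>" "0 \<le> K'"
proof -
  \<comment> \<open>The graph of \<open>H (Suc n)\<close> is the image of the graph of
    \<open>H n\<close> under \<open>(a, u) \<mapsto> (S a u, l * u)\<close>.\<close>
  define H where "H = rec_nat (\<lambda>u::real. 0::real) (\<lambda>_ h y. S (h (y / l)) (y / l))"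
  have H0: "H 0 y = 0" and HS: "H (Suc n) y = S (H n (y / l)) (y / l)" for n y
    by (simp_all add: H_def)
  define L where "L = \<bar>l\<bar> powr \<beta>"
  have L: "0 < L" "\<kappa> < L" using l \<kappa> by (auto simp: L_def)
  \<comment> \<open>One graph transform contracts the weighted distance by \<open>\<kappa>\<close>,
    while evaluating the weight at \<open>y / l\<close> costs a factor \<open>1 / L\<close>.\<close>
  define q where "q = \<kappa> / L"
  have q: "0 \<le> q" "q < 1" using \<kappa> L by (auto simp: q_def)
  have div: "\<bar>y / l\<bar> powr \<beta> = \<bar>y\<bar> powr \<beta> / L" for y
    by (simp add: L_def abs_divide powr_divide)
  have step: "\<bar>H (Suc n) y - H n y\<bar> \<le> K / L * \<bar>y\<bar> powr \<beta> * q ^ n" for n y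
  proof (induction n arbitrary: y)
    case 0
    show ?case using S0[of "y / l"] by (simp add: H0 HS div del: abs_divide)
  next
    case (Suc n)
    have "\<bar>H (Suc (Suc n)) y - H (Suc n) y\<bar> \<le> \<kappa> * \<bar>H (Suc n) (y / l) - H n (y / l)\<bar>"
      unfolding HS[of "Suc n"] HS[of n y] by (rule lip)
    also have "\<dots> \<le> \<kappa> * (K / L * \<bar>y / l\<bar> powr \<beta> * q ^ n)"
      by (intro mult_left_mono Suc \<kappa>(1))
    also have "\<dots> = K / L * \<bar>y\<bar> powr \<beta> * q ^ Suc n"
      by (simp add: div q_def del: abs_divide)
    finally show ?case .
  qed
  have "\<exists>z. (\<lambda>n. H n y) \<longlonglongrightarrow> z \<and> (\<forall>n. \<bar>z - H n y\<bar> \<le> K / L * \<bar>y\<bar> powr \<beta> * q ^ n / (1 - q))" for y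
    using geometric_increments_limit[of "\<lambda>n. H n y" "K / L * \<bar>y\<bar> powr \<beta>" q] step q
    by (metis real_norm_def)
  then obtain h where h: "\<And>y. (\<lambda>n. H n y) \<longlonglongrightarrow> h y"
      and hb: "\<And>n y. \<bar>h y - H n y\<bar> \<le> K / L * \<bar>y\<bar> powr \<beta> * q ^ n / (1 - q)"
    by metis
  have contH: "continuous_on UNIV (H n)" for n
  proof (induction n)
    case 0
    then show ?case by (simp add: H0[abs_def])
  next
    case (Suc n)
    have c1: "continuous_on UNIV (\<lambda>y. H n (y / l))"
      by (rule continuous_on_compose2[OF Suc]) (auto intro!: continuous_intros simp: l)
    have "continuous_on UNIV (\<lambda>y. (\<lambda>(a, u). S a u) (H n (y / l), y / l))"
      by (rule continuous_on_compose2[OF contS]) (use c1 l in \<open>auto intro!: continuous_intros\<close>)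
    then show ?case by (simp add: HS[abs_def])
  qed
  have conth: "continuous_on UNIV h"
  proof (rule continuous_at_imp_continuous_on, rule ballI)
    fix x :: real
    \<comment> \<open>The error bound carries the unbounded weight
      \<open>\<bar>y\<bar> powr \<beta>\<close>, so it is made uniform on balls rather than on the
      whole line.\<close>
    have "continuous_on (ball x 1) h"
    proof (rule continuous_on_geometric_limit[OF _ _ q])
      show "continuous_on (ball x 1) (H n)" for n
        using contH by (rule continuous_on_subset) simp
      show "norm (h y - H n y) \<le> K / L * (\<bar>x\<bar> + 1) powr \<beta> / (1 - q) * q ^ n" if "y \<in> ball x 1" for n y
      proof -
        have "\<bar>y\<bar> powr \<beta> \<le> (\<bar>x\<bar> + 1) powr \<beta>"
          using that \<beta> by (intro powr_mono2) (auto simp: dist_real_def)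
        then have "K / L * \<bar>y\<bar> powr \<beta> / (1 - q) * q ^ n \<le> K / L * (\<bar>x\<bar> + 1) powr \<beta> / (1 - q) * q ^ n"
          using K L q by (intro mult_right_mono divide_right_mono mult_left_mono) auto
        with hb[of y n] show ?thesis by simp
      qed
    qed
    then show "isCont h x" by (simp add: continuous_on_eq_continuous_at)
  qed
  have "h (l * u) = S (h u) u" for u
  proof -
    have "(\<lambda>n. S (H n u) u) \<longlonglongrightarrow> S (h u) u"
    proof (rule LIM_zero_cancel, rule Lim_null_comparison)
      show "\<forall>\<^sub>F n in sequentially. norm (S (H n u) u - S (h u) u) \<le> \<kappa> * \<bar>H n u - h u\<bar>"
        using lip by simp
      have "(\<lambda>n. \<kappa> * \<bar>H n u - h u\<bar>) \<longlonglongrightarrow> \<kappa> * \<bar>h u - h u\<bar>"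
        by (intro tendsto_intros h)
      then show "(\<lambda>n. \<kappa> * \<bar>H n u - h u\<bar>) \<longlonglongrightarrow> 0" by simp
    qed
    moreover have "(\<lambda>n. H (Suc n) (l * u)) \<longlonglongrightarrow> h (l * u)"
      by (rule LIMSEQ_Suc[OF h])
    ultimately show ?thesis
      using l by (simp add: HS LIMSEQ_unique)
  qed
  moreover have "\<bar>h u\<bar> \<le> K / L / (1 - q) * \<bar>u\<bar> powr \<beta>" for u
    using hb[of u 0] by (simp add: H0)
  moreover have "0 \<le> K / L / (1 - q)" using K L q by simp
  ultimately show ?thesis using conth by (intro that) auto
qed

section \<open>The weak coordinate\<close>

lemma diag2_nth [simp]:
  "(diag2 a b *v x) $ 1 = a * x $ 1" "(diag2 a b *v x) $ 2 = b * x $ 2"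
  by (simp_all add: diag2_def matrix_vector_mult_def sum_2)

lemma norm_le_abs_sum2: "norm (x :: real^2) \<le> \<bar>x $ 1\<bar> + \<bar>x $ 2\<bar>"
  using norm_le_l1_cart[of x] by (simp add: sum_2)

lemma abs_nth_le_norm: "\<bar>x $ i\<bar> \<le> norm (x :: real^'n)"
  using component_le_norm_cart[of x i] by simp

lemma norm_diag2_le:
  assumes "\<bar>a\<bar> \<le> \<bar>b\<bar>"
  shows "norm (diag2 a b *v x) \<le> \<bar>b\<bar> * norm x"
proof -
  have "\<bar>(diag2 a b *v x) $ i\<bar> \<le> \<bar>(b *\<^sub>R x) $ i\<bar>" for i
    using exhaust_2[of i] assms by (auto simp: abs_mult intro!: mult_right_mono)
  then have "norm (diag2 a b *v x) \<le> norm (b *\<^sub>R x)"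
    by (intro norm_le_componentwise_cart) simp
  then show ?thesis by simp
qed

section \<open>The contraction on a small ball and its orbits\<close>

text \<open>All smallness requirements on the radius \<open>r\<close> are collected here.
  \<open>\<rho>\<close> bounds the contraction rate on the ball, and \<open>C\<close> sums the
  geometric series behind the weak coordinate. \<open>lip_small\<close> makes the graph transform
  contract, its factor 2 coming from straightening the fibres; \<open>dist_small\<close> keeps the
  accumulated relative error along fibres below 1/2.\<close>

locale planar_contraction =
  fixes lam1 lam2 \<alpha> M r \<rho> C :: real and F f :: "real^2 \<Rightarrow> real^2"
  assumes lam: "0 < \<bar>lam1\<bar>" "\<bar>lam1\<bar> < \<bar>lam2\<bar>"
    and \<alpha>: "0 < \<alpha>" and M: "0 \<le> M" and r: "0 < r"
    and F_eq: "\<And>x. F x = diag2 lam1 lam2 *v x + f x"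
    and f0 [simp]: "f 0 = 0"
    and f_diff: "\<And>x y. norm (f x - f y) \<le> M * max (norm x) (norm y) powr \<alpha> * norm (x - y)"
    and \<rho>: "\<bar>lam2\<bar> + M * r powr \<alpha> \<le> \<rho>" "\<rho> < 1" "\<rho> powr (1 + \<alpha>) < \<bar>lam2\<bar>"
    and C_def: "C = M / \<bar>lam2\<bar> / (1 - \<rho> powr (1 + \<alpha>) / \<bar>lam2\<bar>)"
    and C_small: "C * r powr \<alpha> \<le> 1 / 2"
    and lip_small: "\<bar>lam1\<bar> + 2 * M * r powr \<alpha> < \<bar>lam2\<bar> powr (1 + \<alpha>)"
    and dist_small: "4 * (M * r powr \<alpha> / \<bar>lam1\<bar>) / (1 - \<rho> powr \<alpha>) \<le> 1 / 2"
begin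

lemma lam_nz: "lam1 \<noteq> 0" "lam2 \<noteq> 0" "0 < \<bar>lam2\<bar>"
  using lam by auto

lemma \<rho>_pos: "0 < \<rho>"
proof -
  have "0 \<le> M * r powr \<alpha>" using M by simp
  with \<rho> lam show ?thesis by linarith
qed

lemma \<rho>_powr: "0 < \<rho> powr \<alpha>" "\<rho> powr \<alpha> < 1"
  using \<rho>_pos \<rho> \<alpha> powr_less_mono2[of \<alpha> \<rho> 1] by auto

lemma F_nth: "F x $ 1 = lam1 * x $ 1 + f x $ 1" "F x $ 2 = lam2 * x $ 2 + f x $ 2"
  by (simp_all add: F_eq)

lemma F0 [simp]: "F 0 = 0"
  by (simp add: F_eq)

lemma F_orbit0 [simp]: "(F ^^ n) 0 = 0"
  by (induction n) auto

lemma f_lip: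
  assumes "norm x \<le> r" "norm y \<le> r"
  shows "norm (f x - f y) \<le> M * r powr \<alpha> * norm (x - y)"
proof -
  have "max (norm x) (norm y) powr \<alpha> \<le> r powr \<alpha>"
    using assms \<alpha> by (intro powr_mono2) (auto simp: le_max_iff_disj)
  then show ?thesis
    using f_diff[of x y] M by (meson mult_left_mono mult_right_mono norm_ge_zero order_trans)
qed

lemma F_lip:
  assumes "norm x \<le> r" "norm y \<le> r"
  shows "norm (F x - F y) \<le> \<rho> * norm (x - y)"
proof -
  have "F x - F y = diag2 lam1 lam2 *v (x - y) + (f x - f y)"
    by (simp add: F_eq matrix_vector_mult_diff_distrib)
  then have "norm (F x - F y) \<le> \<bar>lam2\<bar> * norm (x - y) + M * r powr \<alpha> * norm (x - y)"
    using norm_diag2_le[of lam1 lam2 "x - y"] f_lip[OF assms] lam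
    by (smt (verit) norm_triangle_ineq)
  also have "\<dots> \<le> \<rho> * norm (x - y)"
    using \<rho>(1) mult_right_mono[OF \<rho>(1), of "norm (x - y)"] by (simp add: distrib_right)
  finally show ?thesis .
qed

lemma F_norm:
  assumes "norm x \<le> r"
  shows "norm (F x) \<le> \<rho> * norm x"
  using F_lip[OF assms, of 0] r by simp

lemma F_ball:
  assumes "norm x \<le> s" "s \<le> r"
  shows "norm (F x) \<le> s"
proof -
  have "norm (F x) \<le> \<rho> * norm x" using assms by (intro F_norm) simp
  also have "\<dots> \<le> 1 * norm x" using \<rho> by (intro mult_right_mono) auto
  finally show ?thesis using assms by simp
qed

lemma orbit_norm:
  assumes "norm x \<le> r"
  shows "norm ((F ^^ n) x) \<le> r" "norm ((F ^^ n) x) \<le> \<rho> ^ n * norm x"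
proof -
  show *: "norm ((F ^^ n) x) \<le> r" for n
    by (induction n) (use assms F_ball in auto)
  show "norm ((F ^^ n) x) \<le> \<rho> ^ n * norm x"
  proof (induction n)
    case (Suc n)
    have "norm ((F ^^ Suc n) x) \<le> \<rho> * norm ((F ^^ n) x)"
      using F_norm[OF *] by simp
    also have "\<dots> \<le> \<rho> * (\<rho> ^ n * norm x)"
      using Suc \<rho>_pos by (intro mult_left_mono) auto
    finally show ?case by simp
  qed simp
qed

lemma orbit_lip:
  assumes "norm x \<le> r" "norm y \<le> r"
  shows "norm ((F ^^ n) x - (F ^^ n) y) \<le> \<rho> ^ n * norm (x - y)"
proof (induction n)
  case (Suc n)
  have "norm ((F ^^ Suc n) x - (F ^^ Suc n) y) \<le> \<rho> * norm ((F ^^ n) x - (F ^^ n) y)"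
    using F_lip orbit_norm(1) assms by simp
  also have "\<dots> \<le> \<rho> * (\<rho> ^ n * norm (x - y))"
    using Suc \<rho>_pos by (intro mult_left_mono) auto
  finally show ?case by simp
qed simp

lemma orbit_continuous: "continuous_on (cball 0 r) (F ^^ n)"
proof (rule continuous_onI)
  fix x :: "real^2" and \<epsilon> :: real
  assume "x \<in> cball 0 r" "0 < \<epsilon>"
  then show "\<exists>d>0. \<forall>x'\<in>cball 0 r. dist x' x < d \<longrightarrow> dist ((F ^^ n) x') ((F ^^ n) x) \<le> \<epsilon>"
  proof (intro exI[of _ \<epsilon>] conjI ballI impI)
    fix x' :: "real^2" assume x': "x' \<in> cball 0 r" "dist x' x < \<epsilon>"
    have "norm ((F ^^ n) x' - (F ^^ n) x) \<le> \<rho> ^ n * norm (x' - x)"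
      using orbit_lip x' \<open>x \<in> cball 0 r\<close> by simp
    also have "\<dots> \<le> 1 * norm (x' - x)"
      using \<rho> \<rho>_pos by (intro mult_right_mono power_le_one) auto
    finally show "dist ((F ^^ n) x') ((F ^^ n) x) \<le> \<epsilon>"
      using x' by (simp add: dist_norm)
  qed
qed

text \<open>Orbits shrink like \<open>\<rho> ^ n\<close>, so the Hoelder weight supplies a summable
  factor. The distance of the two orbits is left unestimated: the weak coordinate bounds it by
  \<open>\<rho> ^ n\<close>, the strong one by the gap of first components on a fibre.\<close>

lemma f_orbit_diff:
  assumes "norm x \<le> r" "norm y \<le> r"
  shows "norm (f ((F ^^ n) x) - f ((F ^^ n) y)) \<le>
    M * max (norm x) (norm y) powr \<alpha> * (\<rho> powr \<alpha>) ^ n * norm ((F ^^ n) x - (F ^^ n) y)"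
proof -
  let ?m = "max (norm x) (norm y)"
  have "norm ((F ^^ n) x) \<le> \<rho> ^ n * ?m" "norm ((F ^^ n) y) \<le> \<rho> ^ n * ?m"
    using orbit_norm(2)[OF assms(1), of n] orbit_norm(2)[OF assms(2), of n] \<rho>_pos
    by (meson max.cobounded1 max.cobounded2 mult_left_mono order_trans zero_le_power less_imp_le)+
  then have "max (norm ((F ^^ n) x)) (norm ((F ^^ n) y)) powr \<alpha> \<le> (\<rho> ^ n * ?m) powr \<alpha>"
    using \<alpha> by (intro powr_mono2) (auto simp: le_max_iff_disj)
  also have "\<dots> = ?m powr \<alpha> * (\<rho> powr \<alpha>) ^ n"
    using \<rho>_pos by (simp add: powr_mult powr_power powr_powr ac_simps flip: powr_realpow)
  finally have "M * max (norm ((F ^^ n) x)) (norm ((F ^^ n) y)) powr \<alpha> * norm ((F ^^ n) x - (F ^^ n) y)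
      \<le> M * (?m powr \<alpha> * (\<rho> powr \<alpha>) ^ n) * norm ((F ^^ n) x - (F ^^ n) y)"
    using M by (intro mult_right_mono mult_left_mono) auto
  with f_diff[of "(F ^^ n) x" "(F ^^ n) y"] show ?thesis by (simp add: mult.assoc)
qed

text \<open>Corrections at two points differ by a geometric sequence of ratio
  \<open>\<rho> powr (1 + \<alpha>) / \<bar>lam2\<bar> < 1\<close>:
  \<open>\<rho> powr \<alpha>\<close> comes from the Hoelder weight and \<open>\<rho>\<close> from
  the contraction of distances. Estimating differences instead of values gives the Lipschitz-type
  bound directly.\<close>

lemma weak_coordinate_exists:
  obtains \<phi> where "\<phi> 0 = 0" "\<And>x. norm x \<le> r \<Longrightarrow> \<phi> (F x) = lam2 * \<phi> x"
    "\<And>x y. norm x \<le> r \<Longrightarrow> norm y \<le> r \<Longrightarrow>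
      \<bar>(\<phi> x - x $ 2) - (\<phi> y - y $ 2)\<bar> \<le> C * max (norm x) (norm y) powr \<alpha> * norm (x - y)"
proof -
  define a where "a = (\<lambda>n x. (F ^^ n) x $ 2 / lam2 ^ n)"
  define q where "q = \<rho> powr (1 + \<alpha>) / \<bar>lam2\<bar>"
  have q: "0 \<le> q" "q < 1" using \<rho> lam_nz by (auto simp: q_def)
  have C: "C = M / \<bar>lam2\<bar> / (1 - q)" by (simp add: C_def q_def)
  \<comment> \<open>The linear part cancels against the normalization, so only the remainder is
    left.\<close>
  have a_Suc: "a (Suc n) x - a n x = f ((F ^^ n) x) $ 2 / lam2 ^ Suc n" for n x
    using lam_nz by (simp add: a_def F_nth field_simps)
  have step: "norm ((a (Suc n) x - a (Suc n) y) - (a n x - a n y)) \<le>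
      M * max (norm x) (norm y) powr \<alpha> * norm (x - y) / \<bar>lam2\<bar> * q ^ n"
    if xy: "norm x \<le> r" "norm y \<le> r" for x y n
  proof -
    let ?m = "max (norm x) (norm y) powr \<alpha>"
    have "(a (Suc n) x - a (Suc n) y) - (a n x - a n y) = (a (Suc n) x - a n x) - (a (Suc n) y - a n y)"
      by simp
    also have "\<dots> = (f ((F ^^ n) x) - f ((F ^^ n) y)) $ 2 / lam2 ^ Suc n"
      unfolding a_Suc by (simp add: diff_divide_distrib)
    finally have "norm ((a (Suc n) x - a (Suc n) y) - (a n x - a n y))
        = \<bar>(f ((F ^^ n) x) - f ((F ^^ n) y)) $ 2\<bar> / \<bar>lam2\<bar> ^ Suc n"
      by (simp add: power_abs abs_mult)
    also have "\<dots> \<le> (M * ?m * (\<rho> powr \<alpha>) ^ n * (\<rho> ^ n * norm (x - y))) / \<bar>lam2\<bar> ^ Suc n"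
    proof (rule divide_right_mono)
      have "\<bar>(f ((F ^^ n) x) - f ((F ^^ n) y)) $ 2\<bar> \<le>
          M * ?m * (\<rho> powr \<alpha>) ^ n * norm ((F ^^ n) x - (F ^^ n) y)"
        using f_orbit_diff[OF xy] abs_nth_le_norm order_trans by blast
      also have "\<dots> \<le> M * ?m * (\<rho> powr \<alpha>) ^ n * (\<rho> ^ n * norm (x - y))"
        using orbit_lip[OF xy] M by (intro mult_left_mono) auto
      finally show "\<bar>(f ((F ^^ n) x) - f ((F ^^ n) y)) $ 2\<bar> \<le>
        M * ?m * (\<rho> powr \<alpha>) ^ n * (\<rho> ^ n * norm (x - y))" .
    qed simp
    also have "\<dots> = M * ?m * norm (x - y) / \<bar>lam2\<bar> * q ^ n"
      using \<rho>_pos by (simp add: q_def powr_add power_divide power_mult_distrib)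
    finally show ?thesis .
  qed
  have a0: "a n 0 = 0" for n by (simp add: a_def)
  define \<phi> where "\<phi> = (\<lambda>x. lim (\<lambda>n. a n x))"
  have conv: "(\<lambda>n. a n x) \<longlonglongrightarrow> \<phi> x" if x: "norm x \<le> r" for x
  proof -
    have 0: "norm (0 :: real^2) \<le> r" using r by simp
    \<comment> \<open>Since \<open>a n 0 = 0\<close>, the two-point estimate against the origin
      already gives pointwise convergence.\<close>
    obtain l where "(\<lambda>n. a n x - a n 0) \<longlonglongrightarrow> l"
      using geometric_increments_limit[of "\<lambda>n. a n x - a n 0", OF step[OF x 0] q] by blast
    then show ?thesis unfolding \<phi>_def a0 by (simp add: limI)
  qed
  have "\<phi> (F x) = lam2 * \<phi> x" if x: "norm x \<le> r" for x
  proof -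
    have "a n (F x) = lam2 * a (Suc n) x" for n
      using lam_nz by (simp add: a_def funpow_swap1)
    moreover have "(\<lambda>n. lam2 * a (Suc n) x) \<longlonglongrightarrow> lam2 * \<phi> x"
      by (intro tendsto_intros LIMSEQ_Suc conv x)
    ultimately show ?thesis
      using conv[of "F x"] F_ball[OF x] by (simp add: LIMSEQ_unique)
  qed
  moreover have "\<bar>(\<phi> x - x $ 2) - (\<phi> y - y $ 2)\<bar> \<le> C * max (norm x) (norm y) powr \<alpha> * norm (x - y)"
    if xy: "norm x \<le> r" "norm y \<le> r" for x y
  proof -
    obtain l where l: "(\<lambda>n. a n x - a n y) \<longlonglongrightarrow> l"
      and b: "\<And>n. norm (l - (a n x - a n y)) \<le>
        M * max (norm x) (norm y) powr \<alpha> * norm (x - y) / \<bar>lam2\<bar> * q ^ n / (1 - q)"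
      using geometric_increments_limit[of "\<lambda>n. a n x - a n y", OF step[OF xy] q] by blast
    have "l = \<phi> x - \<phi> y"
      using l tendsto_diff[OF conv[OF xy(1)] conv[OF xy(2)]] by (rule LIMSEQ_unique)
    with b[of 0] show ?thesis by (simp add: a_def C algebra_simps)
  qed
  moreover have "\<phi> 0 = 0"
    using conv[of 0] r by (simp add: a0 LIMSEQ_const_iff)
  ultimately show ?thesis using that by blast
qed

end

section \<open>The invariant curve and the strong coordinate\<close>

lemma continuous_on_vector2 [continuous_intros]:
  fixes f g :: "'a::topological_space \<Rightarrow> real"
  assumes "continuous_on S f" "continuous_on S g"
  shows "continuous_on S (\<lambda>x. vector [f x, g x] :: real^2)"
proof -
  have "(vector [f x, g x] :: real^2) = (\<chi> i. if i = 1 then f x else g x)" for x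
    by (simp add: vec_eq_iff forall_2)
  moreover have "continuous_on S (\<lambda>x. \<chi> i. if i = (1::2) then f x else g x)"
  proof (rule continuous_on_vec_lambda)
    show "continuous_on S (\<lambda>x. if i = (1::2) then f x else g x)" for i
      using assms by (cases "i = 1") auto
  qed
  ultimately show ?thesis by (simp only:)
qed

lemma continuous_on_lipschitz_bound:
  fixes f :: "'a::real_normed_vector \<Rightarrow> 'b::real_normed_vector"
  assumes "\<And>x y. x \<in> S \<Longrightarrow> y \<in> S \<Longrightarrow> norm (f x - f y) \<le> L * norm (x - y)"
  shows "continuous_on S f"
proof (rule lipschitz_on_continuous_on)
  show "\<bar>L\<bar>-lipschitz_on S f"
  proof (rule lipschitz_onI)
    fix x y assume "x \<in> S" "y \<in> S"
    then have "norm (f x - f y) \<le> L * norm (x - y)" by (rule assms)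
    also have "\<dots> \<le> \<bar>L\<bar> * norm (x - y)" by (intro mult_right_mono) auto
    finally show "dist (f x) (f y) \<le> \<bar>L\<bar> * dist x y" by (simp add: dist_norm)
  qed simp
qed

text \<open>A discrete Gronwall argument. \<open>e n\<close> is the partial sum of
  \<open>2 * c * q ^ k\<close> and never exceeds 1, so the drift stays below
  \<open>\<bar>w 0\<bar>\<close>; the resulting bound \<open>2 * \<bar>w 0\<bar>\<close> is what the
  next increment needs.\<close>

lemma geometric_ratio_bound:
  fixes w :: "nat \<Rightarrow> real"
  assumes step: "\<And>n. \<bar>w (Suc n) - w n\<bar> \<le> c * q ^ n * \<bar>w n\<bar>"
    and c: "0 \<le> c" "2 * c / (1 - q) \<le> 1" and q: "0 \<le> q" "q < 1"
  shows "\<bar>w n\<bar> \<le> 2 * \<bar>w 0\<bar>"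
proof -
  define e where "e = (\<lambda>n. 2 * c / (1 - q) * (1 - q ^ n))"
  have e_le: "e n \<le> 1" for n
  proof -
    have "e n \<le> 2 * c / (1 - q) * 1"
      unfolding e_def using c q by (intro mult_left_mono) auto
    with c show ?thesis by simp
  qed
  have e_Suc: "e (Suc n) = e n + 2 * c * q ^ n" for n
    using q by (simp add: e_def field_simps)
  have "\<bar>w n - w 0\<bar> \<le> e n * \<bar>w 0\<bar>"
  proof (induction n)
    case 0
    show ?case by (simp add: e_def)
  next
    case (Suc n)
    have "e n * \<bar>w 0\<bar> \<le> \<bar>w 0\<bar>"
      using mult_right_mono[OF e_le, of "\<bar>w 0\<bar>"] by simp
    with Suc have "\<bar>w n\<bar> \<le> 2 * \<bar>w 0\<bar>" by linarith
    then have "c * q ^ n * \<bar>w n\<bar> \<le> c * q ^ n * (2 * \<bar>w 0\<bar>)"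
      using c q by (intro mult_left_mono) auto
    with step[of n] Suc show ?case by (simp add: e_Suc algebra_simps)
  qed
  also have "\<dots> \<le> \<bar>w 0\<bar>"
    using mult_right_mono[OF e_le, of "\<bar>w 0\<bar>"] by simp
  finally show ?thesis by linarith
qed

locale planar_contraction_weak_coordinate = planar_contraction +
  fixes \<phi> :: "real^2 \<Rightarrow> real"
  assumes \<phi>0: "\<phi> 0 = 0"
    and \<phi>_F: "\<And>x. norm x \<le> r \<Longrightarrow> \<phi> (F x) = lam2 * \<phi> x"
    and \<phi>_diff: "\<And>x y. norm x \<le> r \<Longrightarrow> norm y \<le> r \<Longrightarrow>
      \<bar>(\<phi> x - x $ 2) - (\<phi> y - y $ 2)\<bar> \<le> C * max (norm x) (norm y) powr \<alpha> * norm (x - y)"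
begin

lemma C_nonneg: "0 \<le> C"
  using M \<rho> lam_nz by (simp add: C_def)

text \<open>\<open>C_small\<close> enters here: the factor 1/2 is what inverting
  \<open>(x $ 1, \<phi> x)\<close> and the transversality of the fibres of \<open>\<phi>\<close>
  require.\<close>

lemma \<phi>_lip:
  assumes "norm x \<le> r" "norm y \<le> r"
  shows "\<bar>(\<phi> x - x $ 2) - (\<phi> y - y $ 2)\<bar> \<le> 1 / 2 * norm (x - y)"
proof -
  have "max (norm x) (norm y) powr \<alpha> \<le> r powr \<alpha>"
    using assms \<alpha> by (intro powr_mono2) (auto simp: le_max_iff_disj)
  then have "C * max (norm x) (norm y) powr \<alpha> \<le> C * r powr \<alpha>"
    using C_nonneg by (rule mult_left_mono)
  with C_small have "C * max (norm x) (norm y) powr \<alpha> \<le> 1 / 2" by linarith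
  with \<phi>_diff[OF assms] show ?thesis
    by (meson mult_right_mono norm_ge_zero order_trans)
qed

lemma \<phi>_norm:
  assumes "norm x \<le> r"
  shows "\<bar>\<phi> x\<bar> \<le> 2 * norm x"
proof -
  have "\<bar>\<phi> x - x $ 2\<bar> \<le> 1 / 2 * norm x"
    using \<phi>_lip[OF assms, of 0] \<phi>0 r by simp
  with abs_nth_le_norm[of x 2] show ?thesis by linarith
qed

lemma \<phi>_continuous: "continuous_on (cball 0 r) \<phi>"
proof (rule continuous_on_lipschitz_bound)
  fix x y :: "real^2" assume "x \<in> cball 0 r" "y \<in> cball 0 r"
  then have "\<bar>(\<phi> x - x $ 2) - (\<phi> y - y $ 2)\<bar> \<le> 1 / 2 * norm (x - y)"
    by (intro \<phi>_lip) auto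
  with abs_nth_le_norm[of "x - y" 2] show "norm (\<phi> x - \<phi> y) \<le> 2 * norm (x - y)"
    by (simp, linarith)
qed

lemma \<phi>_orbit:
  assumes "norm x \<le> r"
  shows "\<phi> ((F ^^ n) x) = lam2 ^ n * \<phi> x"
  by (induction n) (use assms \<phi>_F orbit_norm(1) in auto)

text \<open>On a fibre the second components differ by at most half the distance, which can be
  absorbed. Fibres are thus Lipschitz graphs over the first axis.\<close>

lemma norm_diff_le_if_same_\<phi>:
  assumes xy: "norm x \<le> r" "norm y \<le> r" and "\<phi> x = \<phi> y"
  shows "norm (x - y) \<le> 2 * \<bar>x $ 1 - y $ 1\<bar>"
proof -
  have 1: "\<bar>x $ 2 - y $ 2\<bar> \<le> 1 / 2 * norm (x - y)"
    using \<phi>_lip[OF xy] assms(3) by (simp add: abs_minus_commute)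
  have 2: "norm (x - y) \<le> \<bar>x $ 1 - y $ 1\<bar> + \<bar>x $ 2 - y $ 2\<bar>"
    using norm_le_abs_sum2[of "x - y"] by simp
  have "n \<le> 2 * a" if "b \<le> 1 / 2 * n" "n \<le> a + b" for a b n :: real
    using that by linarith
  from this[OF 1 2] show ?thesis .
qed

text \<open>In the coordinates \<open>(x $ 1, \<phi> x)\<close> the map becomes the skew product
  \<open>(a, u) \<mapsto> (S a u, lam2 * u)\<close>, to which \<open>invariant_graph\<close> applies
  with weight exponent \<open>1 + \<alpha>\<close>. The last two clauses carry the graph back to the
  ball.\<close>

lemma invariant_curve:
  obtains h K where "continuous_on UNIV h" "\<And>u. \<bar>h u\<bar> \<le> K * \<bar>u\<bar> powr (1 + \<alpha>)" "0 \<le> K"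
    "\<And>z. norm z \<le> r \<Longrightarrow> z $ 1 = h (\<phi> z) \<Longrightarrow> F z $ 1 = h (\<phi> (F z))"
    "\<And>u. \<bar>h u\<bar> + \<bar>u\<bar> \<le> r / 2 \<Longrightarrow> \<exists>z. norm z \<le> 2 * (\<bar>h u\<bar> + \<bar>u\<bar>) \<and> \<phi> z = u \<and> z $ 1 = h u"
proof -
  obtain c :: "real^2 \<Rightarrow> real^2" where c: "\<And>x. norm (c x) \<le> r" "\<And>x. norm (c x) \<le> norm x"
      "\<And>x y. norm (c x - c y) \<le> norm (x - y)" "\<And>x. norm x \<le> r \<Longrightarrow> c x = x"
    by (rule cball_retraction[OF r]) blast
  \<comment> \<open>On the ball \<open>x + p x\<close> is \<open>(x $ 1, \<phi> x)\<close>; the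
    retraction \<open>c\<close> makes \<open>p\<close> a global 1/2-contraction.\<close>
  define p :: "real^2 \<Rightarrow> real^2" where "p = (\<lambda>x. vector [0, \<phi> (c x) - c x $ 2])"
  have c0: "c 0 = 0" using c(4)[of 0] r by simp
  have p0: "p 0 = 0"
    unfolding p_def c0 \<phi>0 by (simp add: vec_eq_iff forall_2)
  have "norm (p x - p y) \<le> 1 / 2 * norm (x - y)" for x y
  proof -
    have "norm (p x - p y) \<le> \<bar>(\<phi> (c x) - c x $ 2) - (\<phi> (c y) - c y $ 2)\<bar>"
      using norm_le_abs_sum2[of "p x - p y"] by (simp add: p_def)
    also have "\<dots> \<le> 1 / 2 * norm (c x - c y)" by (rule \<phi>_lip[OF c(1) c(1)])
    also have "\<dots> \<le> 1 / 2 * norm (x - y)" using c(3) by simp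
    finally show ?thesis .
  qed
  then obtain Q where Q: "\<And>y. Q y + p (Q y) = y" "\<And>x. Q (x + p x) = x"
      "\<And>y z. norm (Q y - Q z) \<le> 2 * norm (y - z)"
    by (rule perturbed_identity_inverse) blast
  have Q0: "Q 0 = 0" using Q(2)[of 0] p0 by simp
  \<comment> \<open>First component of the remainder in straightened coordinates; the inverse
    \<open>Q\<close> doubles its Lipschitz constant.\<close>
  define g where "g = (\<lambda>y. f (c (Q y)) $ 1)"
  have g_lip: "\<bar>g y - g z\<bar> \<le> 2 * M * r powr \<alpha> * norm (y - z)" for y z
  proof -
    have "\<bar>g y - g z\<bar> \<le> norm (f (c (Q y)) - f (c (Q z)))"
      using abs_nth_le_norm[of "f (c (Q y)) - f (c (Q z))" 1] by (simp add: g_def)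
    also have "\<dots> \<le> M * r powr \<alpha> * norm (c (Q y) - c (Q z))" by (rule f_lip[OF c(1) c(1)])
    also have "\<dots> \<le> M * r powr \<alpha> * (2 * norm (y - z))"
      using M order_trans[OF c(3) Q(3)] by (intro mult_left_mono) auto
    finally show ?thesis by simp
  qed
  define S where "S = (\<lambda>a u. lam1 * a + g (vector [a, u]))"
  have S_lip: "\<bar>S a u - S b u\<bar> \<le> (\<bar>lam1\<bar> + 2 * M * r powr \<alpha>) * \<bar>a - b\<bar>" for a b u
  proof -
    have "norm (vector [a, u] - vector [b, u] :: real^2) \<le> \<bar>a - b\<bar>"
      using norm_le_abs_sum2[of "vector [a, u] - vector [b, u]"] by simp
    then have "2 * M * r powr \<alpha> * norm (vector [a, u] - vector [b, u] :: real^2)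
        \<le> 2 * M * r powr \<alpha> * \<bar>a - b\<bar>"
      using M by (intro mult_left_mono) auto
    with g_lip have "\<bar>g (vector [a, u]) - g (vector [b, u])\<bar> \<le> 2 * M * r powr \<alpha> * \<bar>a - b\<bar>"
      using order_trans by blast
    moreover have "S a u - S b u = lam1 * (a - b) + (g (vector [a, u]) - g (vector [b, u]))"
      by (simp add: S_def algebra_simps)
    ultimately have "\<bar>S a u - S b u\<bar> \<le> \<bar>lam1 * (a - b)\<bar> + 2 * M * r powr \<alpha> * \<bar>a - b\<bar>"
      by (metis abs_triangle_ineq add_left_mono order_trans)
    then show ?thesis by (simp add: distrib_right abs_mult)
  qed
  \<comment> \<open>At \<open>a = 0\<close> the linear term vanishes, and the point where
    \<open>f\<close> is evaluated has norm at most \<open>2 * \<bar>u\<bar>\<close>.\<close>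
  have S0: "\<bar>S 0 u\<bar> \<le> M * 2 powr (1 + \<alpha>) * \<bar>u\<bar> powr (1 + \<alpha>)" for u
  proof -
    let ?z = "c (Q (vector [0, u]))"
    have z: "norm ?z \<le> 2 * \<bar>u\<bar>"
      using c(2)[of "Q (vector [0, u])"] Q(3)[of "vector [0, u]" 0]
        norm_le_abs_sum2[of "vector [0, u]"] by (simp add: Q0)
    have "\<bar>S 0 u\<bar> \<le> norm (f ?z)" using abs_nth_le_norm by (simp add: S_def g_def)
    also have "\<dots> \<le> M * (norm ?z powr \<alpha> * norm ?z)" using f_diff[of ?z 0] by simp
    also have "norm ?z powr \<alpha> * norm ?z = norm ?z powr (1 + \<alpha>)" by (simp add: powr_add)
    also have "M * \<dots> \<le> M * (2 * \<bar>u\<bar>) powr (1 + \<alpha>)"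
      using z M \<alpha> by (intro mult_left_mono powr_mono2) auto
    finally show ?thesis by (simp add: powr_mult mult.assoc)
  qed
  have "continuous_on UNIV g"
    by (rule continuous_on_lipschitz_bound) (use g_lip in auto)
  then have "continuous_on UNIV (\<lambda>x::real \<times> real. g (vector [fst x, snd x]))"
    by (rule continuous_on_compose2) (auto intro!: continuous_intros)
  then have S_cont: "continuous_on UNIV (\<lambda>(a, u). S a u)"
    unfolding S_def case_prod_beta by (intro continuous_intros)
  obtain h K where h: "continuous_on UNIV h" "\<And>u. h (lam2 * u) = S (h u) u"
      "\<And>u. \<bar>h u\<bar> \<le> K * \<bar>u\<bar> powr (1 + \<alpha>)" "0 \<le> K"
    by (rule invariant_graph[OF S_lip S0 S_cont, of lam2])
      (use M \<alpha> lam_nz lip_small in \<open>auto\<close>)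
  have inv: "F z $ 1 = h (\<phi> (F z))" if z: "norm z \<le> r" "z $ 1 = h (\<phi> z)" for z
  proof -
    have "z + p z = vector [z $ 1, \<phi> z]"
      unfolding p_def c(4)[OF z(1)] by (simp add: vec_eq_iff forall_2)
    then have "Q (vector [z $ 1, \<phi> z]) = z" using Q(2)[of z] by simp
    then have "S (z $ 1) (\<phi> z) = F z $ 1"
      using c(4)[OF z(1)] by (simp add: S_def g_def F_nth)
    then show ?thesis using z h(2) \<phi>_F by simp
  qed
  have ex: "\<exists>z. norm z \<le> 2 * (\<bar>h u\<bar> + \<bar>u\<bar>) \<and> \<phi> z = u \<and> z $ 1 = h u"
    if u: "\<bar>h u\<bar> + \<bar>u\<bar> \<le> r / 2" for u
  proof -
    let ?y = "vector [h u, u] :: real^2"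
    let ?z = "Q ?y"
    have z: "norm ?z \<le> 2 * (\<bar>h u\<bar> + \<bar>u\<bar>)"
      using Q(3)[of ?y 0] norm_le_abs_sum2[of ?y] by (simp add: Q0)
    \<comment> \<open>The bound \<open>r / 2\<close> and the Lipschitz constant 2 of
      \<open>Q\<close> put \<open>?z\<close> into the ball, where the retraction is the
      identity.\<close>
    then have "c ?z = ?z" using u by (intro c(4)) simp
    moreover have "(?z + p ?z) $ 1 = ?y $ 1" "(?z + p ?z) $ 2 = ?y $ 2" by (simp_all only: Q(1))
    ultimately have "\<phi> ?z = u" "?z $ 1 = h u" by (simp_all add: p_def)
    with z show ?thesis by blast
  qed
  show ?thesis by (rule that[OF h(1,3,4) inv ex])
qed

text \<open>Since \<open>\<phi>\<close> conjugates the second component to a linear map, orbits on a common fibre of \<open>\<phi>\<close>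
  stay on common fibres, and their distance is contracted by \<open>lam1\<close> up to summable relative errors.\<close>

lemma fibre_distance_limit:
  assumes xy: "norm x \<le> r" "norm y \<le> r" and same: "\<phi> x = \<phi> y"
  obtains l where "(\<lambda>n. ((F ^^ n) x $ 1 - (F ^^ n) y $ 1) / lam1 ^ n) \<longlonglongrightarrow> l"
    "\<And>n. \<bar>l - ((F ^^ n) x $ 1 - (F ^^ n) y $ 1) / lam1 ^ n\<bar> \<le>
      4 * (M * max (norm x) (norm y) powr \<alpha> / \<bar>lam1\<bar>) * \<bar>x $ 1 - y $ 1\<bar> * (\<rho> powr \<alpha>) ^ n / (1 - \<rho> powr \<alpha>)"
    "\<bar>l - (x $ 1 - y $ 1)\<bar> \<le> 1 / 2 * \<bar>x $ 1 - y $ 1\<bar>"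
proof -
  define w where "w = (\<lambda>n. ((F ^^ n) x $ 1 - (F ^^ n) y $ 1) / lam1 ^ n)"
  define B where "B = M * max (norm x) (norm y) powr \<alpha> / \<bar>lam1\<bar>"
  define q where "q = \<rho> powr \<alpha>"
  have q: "0 \<le> q" "q < 1" using \<rho>_powr by (auto simp: q_def)
  have B: "0 \<le> B" using M by (simp add: B_def)
  have "max (norm x) (norm y) powr \<alpha> \<le> r powr \<alpha>"
    using xy \<alpha> by (intro powr_mono2) (auto simp: le_max_iff_disj)
  then have "B \<le> M * r powr \<alpha> / \<bar>lam1\<bar>"
    unfolding B_def using M by (intro divide_right_mono mult_left_mono) auto
  then have "4 * B / (1 - q) \<le> 4 * (M * r powr \<alpha> / \<bar>lam1\<bar>) / (1 - q)"
    using q by (intro divide_right_mono) auto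
  also have "\<dots> \<le> 1 / 2" using dist_small by (simp add: q_def)
  finally have small: "4 * B / (1 - q) \<le> 1 / 2" .
  have w0: "w 0 = x $ 1 - y $ 1" by (simp add: w_def)
  \<comment> \<open>On a fibre the distance is at most twice the first-component gap, so the error
    is relative to \<open>w n\<close> itself.\<close>
  have step: "\<bar>w (Suc n) - w n\<bar> \<le> 2 * B * q ^ n * \<bar>w n\<bar>" for n
  proof -
    let ?x = "(F ^^ n) x" and ?y = "(F ^^ n) y"
    have d: "norm (?x - ?y) \<le> 2 * \<bar>?x $ 1 - ?y $ 1\<bar>"
      using xy same by (intro norm_diff_le_if_same_\<phi>) (auto simp: orbit_norm(1) \<phi>_orbit)
    have "w (Suc n) - w n = (f ?x - f ?y) $ 1 / lam1 ^ Suc n"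
      using lam_nz by (simp add: w_def F_nth field_simps)
    then have "\<bar>w (Suc n) - w n\<bar> = \<bar>(f ?x - f ?y) $ 1\<bar> / \<bar>lam1\<bar> ^ Suc n"
      by (simp add: power_abs abs_mult)
    also have "\<dots> \<le> (B * \<bar>lam1\<bar> * q ^ n * (2 * \<bar>?x $ 1 - ?y $ 1\<bar>)) / \<bar>lam1\<bar> ^ Suc n"
    proof (rule divide_right_mono)
      have "\<bar>(f ?x - f ?y) $ 1\<bar> \<le> B * \<bar>lam1\<bar> * q ^ n * norm (?x - ?y)"
        using order_trans[OF abs_nth_le_norm f_orbit_diff[OF xy]] lam_nz
        by (simp add: B_def q_def)
      also have "\<dots> \<le> B * \<bar>lam1\<bar> * q ^ n * (2 * \<bar>?x $ 1 - ?y $ 1\<bar>)"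
        using B q d by (intro mult_left_mono) auto
      finally show "\<bar>(f ?x - f ?y) $ 1\<bar> \<le> B * \<bar>lam1\<bar> * q ^ n * (2 * \<bar>?x $ 1 - ?y $ 1\<bar>)" .
    qed simp
    also have "\<dots> = 2 * B * q ^ n * \<bar>w n\<bar>"
      using lam_nz by (simp add: w_def power_abs abs_divide)
    finally show ?thesis .
  qed
  \<comment> \<open>The ratio bound is used with \<open>c = 2 * B\<close>; its hypothesis
    \<open>4 * B / (1 - q) \<le> 1\<close> holds with room to spare.\<close>
  have bound: "\<bar>w n\<bar> \<le> 2 * \<bar>w 0\<bar>" for n
    by (rule geometric_ratio_bound[OF step _ _ q]) (use B small in auto)
  have step': "norm (w (Suc n) - w n) \<le> 4 * B * \<bar>w 0\<bar> * q ^ n" for n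
  proof -
    have "2 * B * q ^ n * \<bar>w n\<bar> \<le> 2 * B * q ^ n * (2 * \<bar>w 0\<bar>)"
      using bound B q by (intro mult_left_mono) auto
    with step[of n] show ?thesis by (simp add: ac_simps)
  qed
  obtain l where l: "w \<longlonglongrightarrow> l" "\<And>n. norm (l - w n) \<le> 4 * B * \<bar>w 0\<bar> * q ^ n / (1 - q)"
    using geometric_increments_limit[OF step' q] by blast
  \<comment> \<open>A relative error of 1/2 means that \<open>l\<close> vanishes only if the first
    components agree, which later gives injectivity on fibres.\<close>
  have "\<bar>l - w 0\<bar> \<le> 4 * B / (1 - q) * \<bar>w 0\<bar>" using l(2)[of 0] by simp
  also have "\<dots> \<le> 1 / 2 * \<bar>w 0\<bar>" using small by (intro mult_right_mono) auto
  finally have "\<bar>l - w 0\<bar> \<le> 1 / 2 * \<bar>w 0\<bar>" .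
  then show ?thesis
    using that l unfolding w_def B_def q_def by auto
qed

end

text \<open>Lets finitely many smallness conditions on a radius be met at once, by conjunction of
  eventual properties.\<close>

lemma eventually_mult_powr_less_at_right_0:
  fixes A e \<alpha> :: real
  assumes "0 < \<alpha>" "0 < e"
  shows "\<forall>\<^sub>F t in at_right 0. A * t powr \<alpha> < e"
proof -
  have "\<forall>\<^sub>F t in at_right 0. 0 \<le> (t::real)"
    by (rule eventually_mono[OF eventually_at_right_less]) simp
  then have "((\<lambda>t::real. t powr \<alpha>) \<longlongrightarrow> 0) (at_right 0)"
    by (rule tendsto_zero_powrI[OF tendsto_ident_at tendsto_const _ assms(1)])
  then have "((\<lambda>t. A * t powr \<alpha>) \<longlongrightarrow> 0) (at_right 0)"
    by (rule tendsto_mult_right_zero)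
  then show ?thesis using assms(2) by (rule order_tendstoD(2))
qed

section \<open>Construction of the strong coordinate\<close>

context planar_contraction_weak_coordinate
begin

text \<open>The invariant curve supplies a reference point \<open>z\<close> on the fibre of
  \<open>x\<close>, and the normalized fibre gap between \<open>x\<close> and \<open>z\<close>
  converges. Writing that gap through \<open>h\<close> and \<open>\<phi>\<close> makes each
  \<open>w n\<close> continuous without any continuous choice of \<open>z\<close>.\<close>

lemma strong_coordinate_exists:
  obtains \<psi> s B where "0 < s" "s \<le> r" "continuous_on (cball 0 s) \<psi>"
    "\<And>x. norm x \<le> s \<Longrightarrow> \<psi> (F x) = lam1 * \<psi> x"
    "\<And>x. norm x \<le> s \<Longrightarrow> \<bar>\<psi> x - x $ 1\<bar> \<le> B * norm x powr (1 + \<alpha>)"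
    "\<And>x y. norm x \<le> s \<Longrightarrow> norm y \<le> s \<Longrightarrow> \<phi> x = \<phi> y \<Longrightarrow> \<psi> x = \<psi> y \<Longrightarrow> x = y"
proof -
  obtain h K where h_cont: "continuous_on UNIV h"
    and h_bound: "\<And>u. \<bar>h u\<bar> \<le> K * \<bar>u\<bar> powr (1 + \<alpha>)" and K: "0 \<le> K"
    and h_inv: "\<And>z. norm z \<le> r \<Longrightarrow> z $ 1 = h (\<phi> z) \<Longrightarrow> F z $ 1 = h (\<phi> (F z))"
    and h_ex: "\<And>u. \<bar>h u\<bar> + \<bar>u\<bar> \<le> r / 2 \<Longrightarrow>
      \<exists>z. norm z \<le> 2 * (\<bar>h u\<bar> + \<bar>u\<bar>) \<and> \<phi> z = u \<and> z $ 1 = h u"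
    by (rule invariant_curve) blast
  have h_orbit: "(F ^^ n) z $ 1 = h (\<phi> ((F ^^ n) z))" if "norm z \<le> r" "z $ 1 = h (\<phi> z)" for n z
    by (induction n) (use that h_inv orbit_norm(1) in auto)
  obtain t where t: "0 < t" "K * t powr \<alpha> \<le> 1"
  proof -
    have "\<forall>\<^sub>F t in at_right 0. K * t powr \<alpha> < 1"
      using \<alpha> by (rule eventually_mult_powr_less_at_right_0) simp
    with eventually_at_right_less[of "0::real"]
    have "\<forall>\<^sub>F t in at_right 0. 0 < t \<and> K * t powr \<alpha> < 1"
      by eventually_elim simp
    from eventually_happens'[OF trivial_limit_at_right_real this] show ?thesis
      using that less_imp_le by blast
  qed
  \<comment> \<open>\<open>t / 2\<close> gives \<open>\<bar>\<phi> x\<bar> \<le> t\<close>, where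
    \<open>h\<close> is dominated by the identity; \<open>r / 8\<close> allows for
    \<open>norm z \<le> 8 * norm x\<close>.\<close>
  define s where "s = min (t / 2) (r / 8)"
  have s: "0 < s" "2 * s \<le> t" "8 * s \<le> r" using t r by (auto simp: s_def)
  define w where "w = (\<lambda>n x. ((F ^^ n) x $ 1 - h (\<phi> ((F ^^ n) x))) / lam1 ^ n)"
  define q where "q = \<rho> powr \<alpha>"
  have q: "0 \<le> q" "q < 1" using \<rho>_powr by (auto simp: q_def)
  \<comment> \<open>12 is the 4 of the fibre estimate times the 3 in
    \<open>\<bar>x $ 1 - z $ 1\<bar> \<le> 3 * norm x\<close>.\<close>
  define B where "B = 12 * M * 8 powr \<alpha> / \<bar>lam1\<bar> / (1 - q)"
  have B: "0 \<le> B" using M q by (simp add: B_def)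

  have h_le: "\<bar>h (\<phi> x)\<bar> \<le> \<bar>\<phi> x\<bar>" if x: "norm x \<le> s" for x
  proof -
    have "\<bar>\<phi> x\<bar> \<le> 2 * norm x" using x s by (intro \<phi>_norm) simp
    then have "\<bar>\<phi> x\<bar> powr \<alpha> \<le> t powr \<alpha>" using x s \<alpha> by (intro powr_mono2) auto
    then have "K * \<bar>\<phi> x\<bar> powr \<alpha> \<le> K * t powr \<alpha>" using K by (rule mult_left_mono)
    with t have "K * \<bar>\<phi> x\<bar> powr \<alpha> \<le> 1" by linarith
    then have "K * \<bar>\<phi> x\<bar> powr \<alpha> * \<bar>\<phi> x\<bar> \<le> 1 * \<bar>\<phi> x\<bar>" by (intro mult_right_mono) auto
    moreover have "K * \<bar>\<phi> x\<bar> powr (1 + \<alpha>) = K * \<bar>\<phi> x\<bar> powr \<alpha> * \<bar>\<phi> x\<bar>" by (simp add: powr_add)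
    ultimately show ?thesis using h_bound[of "\<phi> x"] by linarith
  qed

  have lim: "\<exists>l. (\<lambda>n. w n x) \<longlonglongrightarrow> l \<and> (\<forall>n. \<bar>l - w n x\<bar> \<le> B * norm x powr (1 + \<alpha>) * q ^ n)"
    if x: "norm x \<le> s" for x
  proof -
    have \<phi>x: "\<bar>\<phi> x\<bar> \<le> 2 * norm x" using x s by (intro \<phi>_norm) simp
    have "\<bar>h (\<phi> x)\<bar> + \<bar>\<phi> x\<bar> \<le> r / 2" using h_le[OF x] \<phi>x x s by linarith
    then obtain z where z: "norm z \<le> 2 * (\<bar>h (\<phi> x)\<bar> + \<bar>\<phi> x\<bar>)" "\<phi> z = \<phi> x" "z $ 1 = h (\<phi> x)"
      using h_ex by blast
    have "\<bar>h (\<phi> x)\<bar> + \<bar>\<phi> x\<bar> \<le> 4 * norm x" using h_le[OF x] \<phi>x by linarith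
    then have "2 * (\<bar>h (\<phi> x)\<bar> + \<bar>\<phi> x\<bar>) \<le> 2 * (4 * norm x)" by (rule mult_left_mono) simp
    with z(1) have zx: "norm z \<le> 8 * norm x" by simp
    have xr: "norm x \<le> r" and zr: "norm z \<le> r" using zx x s by auto
    \<comment> \<open>The orbit of \<open>z\<close> stays on the invariant curve and on the fibres
      of the orbit of \<open>x\<close>, so its first component is the \<open>h\<close> term.\<close>
    have w_eq: "w n x = ((F ^^ n) x $ 1 - (F ^^ n) z $ 1) / lam1 ^ n" for n
      using h_orbit[OF zr, of n] z \<phi>_orbit[OF xr] \<phi>_orbit[OF zr] by (simp add: w_def)
    let ?m = "max (norm x) (norm z)"
    obtain l where l: "(\<lambda>n. w n x) \<longlonglongrightarrow> l"
      and lb: "\<And>n. \<bar>l - w n x\<bar> \<le>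
        4 * (M * ?m powr \<alpha> / \<bar>lam1\<bar>) * \<bar>x $ 1 - z $ 1\<bar> * q ^ n / (1 - q)"
      unfolding w_eq q_def by (rule fibre_distance_limit[OF xr zr z(2)[symmetric]]) blast
    have d: "\<bar>x $ 1 - z $ 1\<bar> \<le> 3 * norm x"
      using abs_nth_le_norm[of x 1] h_le[OF x] \<phi>x z(3) by linarith
    have "?m powr \<alpha> \<le> (8 * norm x) powr \<alpha>" using zx \<alpha> by (intro powr_mono2) (auto simp: le_max_iff_disj)
    then have m: "?m powr \<alpha> \<le> 8 powr \<alpha> * norm x powr \<alpha>" by (simp add: powr_mult)
    have "\<bar>l - w n x\<bar> \<le> B * norm x powr (1 + \<alpha>) * q ^ n" for n
    proof -
      have "4 * (M * ?m powr \<alpha> / \<bar>lam1\<bar>) * \<bar>x $ 1 - z $ 1\<bar> * q ^ n / (1 - q)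
          \<le> 4 * (M * (8 powr \<alpha> * norm x powr \<alpha>) / \<bar>lam1\<bar>) * (3 * norm x) * q ^ n / (1 - q)"
        using q M m d by (intro divide_right_mono mult_right_mono mult_mono mult_left_mono) auto
      also have "\<dots> = B * norm x powr (1 + \<alpha>) * q ^ n"
        by (simp add: B_def powr_add)
      finally show ?thesis using lb[of n] by linarith
    qed
    with l show ?thesis by blast
  qed
  define \<psi> where "\<psi> = (\<lambda>x. lim (\<lambda>n. w n x))"
  have \<psi>: "(\<lambda>n. w n x) \<longlonglongrightarrow> \<psi> x" "\<bar>\<psi> x - w n x\<bar> \<le> B * norm x powr (1 + \<alpha>) * q ^ n"
    if x: "norm x \<le> s" for x n
  proof -
    obtain l where l: "(\<lambda>n. w n x) \<longlonglongrightarrow> l" "\<And>n. \<bar>l - w n x\<bar> \<le> B * norm x powr (1 + \<alpha>) * q ^ n"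
      using lim[OF x] by blast
    moreover have "\<psi> x = l" unfolding \<psi>_def by (rule limI[OF l(1)])
    ultimately show "(\<lambda>n. w n x) \<longlonglongrightarrow> \<psi> x" "\<bar>\<psi> x - w n x\<bar> \<le> B * norm x powr (1 + \<alpha>) * q ^ n"
      by auto
  qed

  have "continuous_on (cball 0 s) \<psi>"
  proof (rule continuous_on_geometric_limit[OF _ _ q])
    fix n
    have orb: "continuous_on (cball 0 s) (F ^^ n)"
      using orbit_continuous by (rule continuous_on_subset) (use s in auto)
    have "continuous_on (cball 0 s) (\<lambda>x. \<phi> ((F ^^ n) x))"
      by (rule continuous_on_compose2[OF \<phi>_continuous orb]) (use orbit_norm(1) s in auto)
    then have "continuous_on (cball 0 s) (\<lambda>x. h (\<phi> ((F ^^ n) x)))"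
      by (rule continuous_on_compose2[OF h_cont]) auto
    then show "continuous_on (cball 0 s) (w n)"
      unfolding w_def using orb lam_nz by (intro continuous_intros) auto
  next
    fix n and x :: "real^2" assume "x \<in> cball 0 s"
    then have x: "norm x \<le> s" by simp
    then have "norm x powr (1 + \<alpha>) \<le> s powr (1 + \<alpha>)" using \<alpha> by (intro powr_mono2) auto
    then have "B * norm x powr (1 + \<alpha>) * q ^ n \<le> B * s powr (1 + \<alpha>) * q ^ n"
      using B q by (intro mult_right_mono mult_left_mono) auto
    with \<psi>(2)[OF x] show "norm (\<psi> x - w n x) \<le> B * s powr (1 + \<alpha>) * q ^ n"
      using order_trans by simp blast
  qed
  moreover have "\<psi> (F x) = lam1 * \<psi> x" if x: "norm x \<le> s" for x
  proof -
    have "w n (F x) = lam1 * w (Suc n) x" for n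
      using lam_nz by (simp add: w_def funpow_swap1)
    moreover have "(\<lambda>n. lam1 * w (Suc n) x) \<longlonglongrightarrow> lam1 * \<psi> x"
      by (intro tendsto_intros LIMSEQ_Suc \<psi> x)
    moreover have "norm (F x) \<le> s" by (rule F_ball[OF x]) (use s in simp)
    ultimately show ?thesis using \<psi>(1)[of "F x"] by (simp add: LIMSEQ_unique)
  qed
  \<comment> \<open>The case \<open>n = 0\<close> compares \<open>\<psi> x\<close> with
    \<open>x $ 1 - h (\<phi> x)\<close>, and \<open>h\<close> is itself of order
    \<open>1 + \<alpha>\<close>.\<close>
  moreover have "\<bar>\<psi> x - x $ 1\<bar> \<le> (B + K * 2 powr (1 + \<alpha>)) * norm x powr (1 + \<alpha>)"
    if x: "norm x \<le> s" for x
  proof -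
    have "\<bar>\<phi> x\<bar> \<le> 2 * norm x" using x s by (intro \<phi>_norm) simp
    then have "\<bar>\<phi> x\<bar> powr (1 + \<alpha>) \<le> (2 * norm x) powr (1 + \<alpha>)" using \<alpha> by (intro powr_mono2) auto
    then have "K * \<bar>\<phi> x\<bar> powr (1 + \<alpha>) \<le> K * (2 * norm x) powr (1 + \<alpha>)" using K by (rule mult_left_mono)
    with h_bound[of "\<phi> x"] have "\<bar>h (\<phi> x)\<bar> \<le> K * 2 powr (1 + \<alpha>) * norm x powr (1 + \<alpha>)"
      by (simp add: powr_mult)
    moreover have "\<bar>\<psi> x - (x $ 1 - h (\<phi> x))\<bar> \<le> B * norm x powr (1 + \<alpha>)"
      using \<psi>(2)[OF x, of 0] by (simp add: w_def)
    ultimately show ?thesis unfolding distrib_right by linarith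
  qed
  \<comment> \<open>On a common fibre the \<open>h\<close> terms cancel, so
    \<open>\<psi> x - \<psi> y\<close> is the limit of the fibre quotients. If it is 0, the relative
    error bound forces equal first components.\<close>
  moreover have "x = y" if xy: "norm x \<le> s" "norm y \<le> s" and eq: "\<phi> x = \<phi> y" "\<psi> x = \<psi> y" for x y
  proof -
    have r: "norm x \<le> r" "norm y \<le> r" using xy s by auto
    obtain l where l: "(\<lambda>n. ((F ^^ n) x $ 1 - (F ^^ n) y $ 1) / lam1 ^ n) \<longlonglongrightarrow> l"
      and lb: "\<bar>l - (x $ 1 - y $ 1)\<bar> \<le> 1 / 2 * \<bar>x $ 1 - y $ 1\<bar>"
      by (rule fibre_distance_limit[OF r eq(1)]) blast
    have "((F ^^ n) x $ 1 - (F ^^ n) y $ 1) / lam1 ^ n = w n x - w n y" for n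
      using \<phi>_orbit[OF r(1)] \<phi>_orbit[OF r(2)] eq(1) by (simp add: w_def diff_divide_distrib)
    with l have "(\<lambda>n. w n x - w n y) \<longlonglongrightarrow> l" by simp
    moreover have "(\<lambda>n. w n x - w n y) \<longlonglongrightarrow> \<psi> x - \<psi> y"
      by (intro tendsto_diff \<psi> xy)
    ultimately have "l = 0" using eq(2) LIMSEQ_unique by fastforce
    with lb have "x $ 1 = y $ 1" by (simp add: abs_minus_commute)
    with norm_diff_le_if_same_\<phi>[OF r eq(1)] show "x = y" by simp
  qed
  moreover have "s \<le> r" using s by simp
  ultimately show ?thesis using s(1) that by blast
qed

end

section \<open>The local linearization\<close>

text \<open>At 0 the bound itself vanishes; elsewhere division by \<open>norm x\<close> leaves
  \<open>norm x powr \<alpha>\<close>, which tends to 0.\<close>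

lemma has_derivative_id_at_0:
  fixes \<Phi> :: "'a::real_normed_vector \<Rightarrow> 'a"
  assumes "0 < s" "0 < \<alpha>" and bound: "\<And>x. norm x < s \<Longrightarrow> norm (\<Phi> x - x) \<le> B * norm x powr (1 + \<alpha>)"
  shows "\<Phi> 0 = 0" "(\<Phi> has_derivative id) (at 0)"
proof -
  show 0: "\<Phi> 0 = 0" using bound[of 0] assms(1) by simp
  have "((\<lambda>x. norm (\<Phi> x - x) / norm x) \<longlongrightarrow> 0) (at 0)"
  proof (rule Lim_null_comparison)
    show "\<forall>\<^sub>F x in at 0. norm (norm (\<Phi> x - x) / norm x) \<le> B * norm x powr \<alpha>"
      unfolding eventually_at
    proof (intro exI[of _ s] conjI ballI impI assms(1))
      fix x :: 'a assume x: "x \<noteq> 0 \<and> dist x 0 < s"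
      then have "norm (\<Phi> x - x) / norm x \<le> B * norm x powr (1 + \<alpha>) / norm x"
        by (intro divide_right_mono bound) auto
      with x show "norm (norm (\<Phi> x - x) / norm x) \<le> B * norm x powr \<alpha>"
        by (simp add: powr_add)
    qed
    have "((\<lambda>x::'a. norm x powr \<alpha>) \<longlongrightarrow> 0) (at 0)"
      using assms(2) by (intro tendsto_zero_powrI[where b = \<alpha>] tendsto_norm_zero tendsto_intros) auto
    then show "((\<lambda>x::'a. B * norm x powr \<alpha>) \<longlongrightarrow> 0) (at 0)"
      by (rule tendsto_mult_right_zero)
  qed
  then show "(\<Phi> has_derivative id) (at 0)"
    by (simp add: has_derivative_iff_norm 0 id_def bounded_linear_ident)
qed

text \<open>Equal values of \<open>\<phi>\<close> put two points on one fibre, where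
  \<open>\<psi>\<close> separates them. Invariance of domain then yields an open image and a
  continuous inverse.\<close>

lemma (in planar_contraction) local_linearization:
  "\<exists>U \<Phi> \<Psi>. open U \<and> 0 \<in> U \<and> homeomorphism U (\<Phi> ` U) \<Phi> \<Psi> \<and>
    (\<forall>\<^sub>F x in nhds 0. x \<in> U \<and> F x \<in> U \<and> \<Phi> (F x) = diag2 lam1 lam2 *v \<Phi> x) \<and>
    \<Phi> 0 = 0 \<and> (\<Phi> has_derivative id) (at 0) \<and> (\<Psi> has_derivative id) (at 0)"
proof -
  obtain \<phi> where \<phi>: "\<phi> 0 = 0" "\<And>x. norm x \<le> r \<Longrightarrow> \<phi> (F x) = lam2 * \<phi> x"
    "\<And>x y. norm x \<le> r \<Longrightarrow> norm y \<le> r \<Longrightarrow>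
      \<bar>(\<phi> x - x $ 2) - (\<phi> y - y $ 2)\<bar> \<le> C * max (norm x) (norm y) powr \<alpha> * norm (x - y)"
    by (rule weak_coordinate_exists) blast
  interpret planar_contraction_weak_coordinate lam1 lam2 \<alpha> M r \<rho> C F f \<phi>
    by unfold_locales (use \<phi> in auto)
  obtain \<psi> s B where s: "0 < s" "s \<le> r" and \<psi>_cont: "continuous_on (cball 0 s) \<psi>"
    and \<psi>_F: "\<And>x. norm x \<le> s \<Longrightarrow> \<psi> (F x) = lam1 * \<psi> x"
    and \<psi>_bound: "\<And>x. norm x \<le> s \<Longrightarrow> \<bar>\<psi> x - x $ 1\<bar> \<le> B * norm x powr (1 + \<alpha>)"
    and inj: "\<And>x y. norm x \<le> s \<Longrightarrow> norm y \<le> s \<Longrightarrow> \<phi> x = \<phi> y \<Longrightarrow> \<psi> x = \<psi> y \<Longrightarrow> x = y"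
    by (rule strong_coordinate_exists) blast
  define U where "U = ball (0 :: real^2) s"
  define \<Phi> :: "real^2 \<Rightarrow> real^2" where "\<Phi> = (\<lambda>x. vector [\<psi> x, \<phi> x])"
  have U: "open U" "0 \<in> U" and U_iff: "x \<in> U \<longleftrightarrow> norm x < s" for x using s by (auto simp: U_def)
  have cont: "continuous_on U \<Phi>"
    unfolding \<Phi>_def
  proof (intro continuous_on_vector2)
    show "continuous_on U \<psi>" using \<psi>_cont by (rule continuous_on_subset) (auto simp: U_iff)
    show "continuous_on U \<phi>" using \<phi>_continuous by (rule continuous_on_subset) (use s in \<open>auto simp: U_iff\<close>)
  qed
  have inj_\<Phi>: "inj_on \<Phi> U"
  proof (rule inj_onI)
    fix x y assume "x \<in> U" "y \<in> U" "\<Phi> x = \<Phi> y"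
    then show "x = y"
      by (intro inj) (auto simp: U_iff \<Phi>_def vec_eq_iff forall_2)
  qed
  obtain \<Psi> where \<Psi>: "homeomorphism U (\<Phi> ` U) \<Phi> \<Psi>"
    using invariance_of_domain_homeomorphism[OF U(1) cont _ inj_\<Phi>] by auto
  have open_img: "open (\<Phi> ` U)" by (rule invariance_of_domain[OF cont U(1) inj_\<Phi>])
  have "norm (\<Phi> x - x) \<le> (B + C) * norm x powr (1 + \<alpha>)" if x: "norm x < s" for x
  proof -
    have "\<bar>\<phi> x - x $ 2\<bar> \<le> C * norm x powr (1 + \<alpha>)"
      using \<phi>(3)[of x 0] x s r \<phi>(1) by (simp add: powr_add ac_simps)
    moreover have "norm (\<Phi> x - x) \<le> \<bar>\<psi> x - x $ 1\<bar> + \<bar>\<phi> x - x $ 2\<bar>"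
      using norm_le_abs_sum2[of "\<Phi> x - x"] by (simp add: \<Phi>_def)
    moreover have "\<bar>\<psi> x - x $ 1\<bar> \<le> B * norm x powr (1 + \<alpha>)" using \<psi>_bound x by simp
    ultimately show ?thesis unfolding distrib_right by linarith
  qed
  note D = has_derivative_id_at_0[OF s(1) \<alpha> this]
  have \<Psi>0: "\<Psi> 0 = 0"
    using homeomorphism_apply1[OF \<Psi> U(2)] D(1) by simp
  have img0: "0 \<in> \<Phi> ` U" using U(2) D(1) by force
  \<comment> \<open>Differentiability of \<open>\<Phi>\<close> at the single point 0 and continuity
    of \<open>\<Psi>\<close> there suffice, the image being an open neighbourhood of 0.\<close>
  have "(\<Psi> has_derivative id) (at 0)"
  proof (rule has_derivative_inverse_basic[OF _ _ _ _ open_img img0])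
    show "(\<Phi> has_derivative id) (at (\<Psi> 0))" using D(2) by (simp add: \<Psi>0)
    show "bounded_linear (id :: real^2 \<Rightarrow> real^2)" by (simp add: id_def bounded_linear_ident)
    show "continuous (at 0) \<Psi>"
      using homeomorphism_cont2[OF \<Psi>] img0 continuous_on_eq_continuous_at[OF open_img] by blast
    show "\<Phi> (\<Psi> z) = z" if "z \<in> \<Phi> ` U" for z
      using homeomorphism_apply2[OF \<Psi> that] .
  qed simp
  moreover have "\<forall>\<^sub>F x in nhds 0. x \<in> U \<and> F x \<in> U \<and> \<Phi> (F x) = diag2 lam1 lam2 *v \<Phi> x"
  proof -
    have "x \<in> U \<and> F x \<in> U \<and> \<Phi> (F x) = diag2 lam1 lam2 *v \<Phi> x" if x: "x \<in> U" for x
    proof (intro conjI x)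
      have x: "norm x < s" using x by (simp add: U_iff)
      have "norm (F x) \<le> norm x" by (rule F_ball) (use x s in auto)
      with x show "F x \<in> U" by (simp add: U_iff)
      show "\<Phi> (F x) = diag2 lam1 lam2 *v \<Phi> x"
        using x s \<psi>_F \<phi>(2) by (simp add: \<Phi>_def vec_eq_iff forall_2)
    qed
    then show ?thesis using U eventually_nhds by blast
  qed
  ultimately show ?thesis using U \<Psi> D by blast
qed

section \<open>From the hypotheses on \<open>F\<close> to the contraction estimates\<close>

text \<open>The mean value inequality is applied to \<open>F - L\<close> on the ball about 0
  reaching the farther point; its derivative there is \<open>DF z - DF 0\<close>. The weight thus
  measures distance to the fixed point, which decays along orbits.\<close>

lemma C1_Hoelder_remainder:
  fixes F :: "'a::real_normed_vector \<Rightarrow> 'b::real_normed_vector"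
  assumes "C1_Hoelder \<alpha> F" and \<alpha>: "0 < \<alpha>"
    and L: "(F has_derivative L) (at 0)"
  obtains M where "0 \<le> M"
    "\<And>x y. norm ((F x - L x) - (F y - L y)) \<le> M * max (norm x) (norm y) powr \<alpha> * norm (x - y)"
proof -
  obtain DF where DF: "\<And>x. (F has_derivative blinfun_apply (DF x)) (at x)"
    and bdd: "bdd_above {norm (DF x - DF y) / norm (x - y) powr \<alpha> | x y. x \<noteq> y}"
    using assms(1) unfolding C1_Hoelder_def by blast
  obtain M' where M': "\<And>x y. x \<noteq> y \<Longrightarrow> norm (DF x - DF y) / norm (x - y) powr \<alpha> \<le> M'"
    using bdd unfolding bdd_above_def by blast
  define M where "M = max M' 0"
  have L_eq: "L = blinfun_apply (DF 0)"
    by (rule has_derivative_unique[OF L DF])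
  have M: "norm (DF x - DF 0) \<le> M * norm x powr \<alpha>" for x
  proof (cases "x = 0")
    case False
    then have "norm (DF x - DF 0) / norm x powr \<alpha> \<le> M" using M'[of x 0] by (simp add: M_def)
    with False show ?thesis by (simp add: pos_divide_le_eq)
  qed simp
  have "norm ((F x - L x) - (F y - L y)) \<le> M * max (norm x) (norm y) powr \<alpha> * norm (x - y)" for x y
  proof (rule differentiable_bound)
    let ?B = "cball (0 :: 'a) (max (norm x) (norm y))"
    show "convex ?B" by (rule convex_cball)
    show "x \<in> ?B" "y \<in> ?B" by auto
    fix z assume z: "z \<in> ?B"
    show "((\<lambda>z. F z - L z) has_derivative blinfun_apply (DF z - DF 0)) (at z within ?B)"
      unfolding L_eq blinfun.diff_left
      by (intro has_derivative_diff has_derivative_at_withinI[OF DF] bounded_linear_imp_has_derivative blinfun.bounded_linear_right)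
    have "onorm (blinfun_apply (DF z - DF 0)) = norm (DF z - DF 0)"
      by (simp add: norm_blinfun.rep_eq)
    also have "\<dots> \<le> M * norm z powr \<alpha>" by (rule M)
    also have "\<dots> \<le> M * max (norm x) (norm y) powr \<alpha>"
      using z \<alpha> by (intro mult_left_mono powr_mono2) (auto simp: M_def)
    finally show "onorm (blinfun_apply (DF z - DF 0)) \<le> M * max (norm x) (norm y) powr \<alpha>" .
  qed
  moreover have "0 \<le> M" by (simp add: M_def)
  ultimately show ?thesis by (rule that[rotated])
qed

text \<open>As \<open>ln a < 0\<close>, the bound on \<open>\<alpha>\<close> reads
  \<open>(1 - \<alpha>) * ln a \<le> ln b\<close>. Multiplying by \<open>1 + \<alpha>\<close> leaves
  a surplus \<open>- \<alpha>\<^sup>2 * ln a > 0\<close>, so the inequality is strict even at the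
  critical exponent.\<close>

lemma spectral_gap:
  fixes a b \<alpha> :: real
  assumes "0 < a" "a < b" "b < 1" "0 < \<alpha>" "\<alpha> \<le> 1 - ln b / ln a"
  shows "a < b powr (1 + \<alpha>)"
proof -
  have ln: "ln a < ln b" "ln b < 0" using assms by auto
  have "ln b \<ge> (1 - \<alpha>) * ln a"
    using assms(5) ln by (simp add: field_simps)
  have "\<alpha>\<^sup>2 * ln a < 0"
    using ln assms(4) by (simp add: mult_pos_neg)
  then have "ln a < ln a - \<alpha>\<^sup>2 * ln a" by simp
  also have "\<dots> = (1 + \<alpha>) * ((1 - \<alpha>) * ln a)"
    by (simp add: algebra_simps power2_eq_square)
  also have "\<dots> \<le> (1 + \<alpha>) * ln b"
    using \<open>ln b \<ge> (1 - \<alpha>) * ln a\<close> assms(4) by (intro mult_left_mono) auto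
  finally have "ln a < (1 + \<alpha>) * ln b" .
  then have "exp (ln a) < exp ((1 + \<alpha>) * ln b)" by simp
  then show ?thesis using assms by (simp add: powr_def)
qed

theorem theorem2:
  fixes lam1 lam2 \<alpha> :: real and F :: "real^2 \<Rightarrow> real^2"
  assumes "0 < \<bar>lam1\<bar>" and "\<bar>lam1\<bar> < \<bar>lam2\<bar>" and "\<bar>lam2\<bar> < 1"
    and "0 < \<alpha>" and "\<alpha> \<le> 1 - ln \<bar>lam2\<bar> / ln \<bar>lam1\<bar>"
    and "C1_Hoelder_diffeo \<alpha> F"
    and "F 0 = 0"
    and "(F has_derivative (\<lambda>h. diag2 lam1 lam2 *v h)) (at 0)"
  shows "\<exists>(U :: (real^2) set) (\<Phi> :: real^2 \<Rightarrow> real^2) (\<Psi> :: real^2 \<Rightarrow> real^2).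
    open U \<and> 0 \<in> U \<and> homeomorphism U (\<Phi> ` U) \<Phi> \<Psi> \<and>
    (\<forall>\<^sub>F x in nhds 0. x \<in> U \<and> F x \<in> U \<and> \<Phi> (F x) = diag2 lam1 lam2 *v \<Phi> x) \<and>
    \<Phi> 0 = 0 \<and>
    (\<Phi> has_derivative id) (at 0) \<and> (\<Psi> has_derivative id) (at 0)"
proof -
  define f where "f = (\<lambda>x. F x - diag2 lam1 lam2 *v x)"
  obtain M where M: "0 \<le> M"
    and f: "\<And>x y. norm (f x - f y) \<le> M * max (norm x) (norm y) powr \<alpha> * norm (x - y)"
    using C1_Hoelder_remainder[OF _ assms(4,8)] assms(6)
    unfolding C1_Hoelder_diffeo_def f_def by blast
  \<comment> \<open>Chosen so that \<open>\<rho> powr (1 + \<alpha> / 2) = \<bar>lam2\<bar>\<close>;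
    hence \<open>\<rho>\<close> lies strictly between \<open>\<bar>lam2\<bar>\<close> and 1, and the
    larger exponent \<open>1 + \<alpha>\<close> brings it below
    \<open>\<bar>lam2\<bar>\<close>.\<close>
  define \<rho> where "\<rho> = \<bar>lam2\<bar> powr (1 / (1 + \<alpha> / 2))"
  have l2: "0 < \<bar>lam2\<bar>" using assms(1,2) by linarith
  have \<rho>1: "\<rho> < 1" "0 < \<rho>"
    using powr_less_mono'[OF l2 assms(3), of 0 "1 / (1 + \<alpha> / 2)"] assms(4) l2 by (auto simp: \<rho>_def)
  have \<rho>2: "\<bar>lam2\<bar> < \<rho>"
    using powr_less_mono'[OF l2 assms(3), of "1 / (1 + \<alpha> / 2)" 1] assms(4) by (simp add: \<rho>_def)
  have "1 < 1 / (1 + \<alpha> / 2) * (1 + \<alpha>)" using assms(4) by (simp add: field_simps)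
  from powr_less_mono'[OF l2 assms(3) this]
  have \<rho>3: "\<rho> powr (1 + \<alpha>) < \<bar>lam2\<bar>" by (simp add: \<rho>_def powr_powr)
  have q: "\<rho> powr \<alpha> < 1" using \<rho>1 assms(4) powr_less_mono2[of \<alpha> \<rho> 1] by simp
  have gap: "\<bar>lam1\<bar> < \<bar>lam2\<bar> powr (1 + \<alpha>)" by (rule spectral_gap[OF assms(1-5)])
  define C where "C = M / \<bar>lam2\<bar> / (1 - \<rho> powr (1 + \<alpha>) / \<bar>lam2\<bar>)"
  note small = eventually_mult_powr_less_at_right_0[OF assms(4)]
  \<comment> \<open>\<open>\<rho>\<close> and \<open>C\<close> are fixed before \<open>r\<close>, so
    apart from positivity each condition puts a constant times \<open>r powr \<alpha>\<close> below
    a positive threshold.\<close>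
  have "\<forall>\<^sub>F r in at_right 0. 0 < r \<and> M * r powr \<alpha> < \<rho> - \<bar>lam2\<bar> \<and> C * r powr \<alpha> < 1 / 2 \<and>
      2 * M * r powr \<alpha> < \<bar>lam2\<bar> powr (1 + \<alpha>) - \<bar>lam1\<bar> \<and>
      4 * M / \<bar>lam1\<bar> / (1 - \<rho> powr \<alpha>) * r powr \<alpha> < 1 / 2"
    by (intro eventually_conj small eventually_at_right_less) (use \<rho>2 gap in auto)
  then obtain r where r: "0 < r" "M * r powr \<alpha> < \<rho> - \<bar>lam2\<bar>" "C * r powr \<alpha> < 1 / 2"
      "2 * M * r powr \<alpha> < \<bar>lam2\<bar> powr (1 + \<alpha>) - \<bar>lam1\<bar>"
      "4 * M / \<bar>lam1\<bar> / (1 - \<rho> powr \<alpha>) * r powr \<alpha> < 1 / 2"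
    using eventually_happens'[OF trivial_limit_at_right_real] by blast
  have "planar_contraction lam1 lam2 \<alpha> M r \<rho> C F f"
  proof
    show "4 * (M * r powr \<alpha> / \<bar>lam1\<bar>) / (1 - \<rho> powr \<alpha>) \<le> 1 / 2"
      using r(5) by simp
    show "F x = diag2 lam1 lam2 *v x + f x" for x by (simp add: f_def)
    show "f 0 = 0" using assms(7) by (simp add: f_def)
    show "\<bar>lam2\<bar> + M * r powr \<alpha> \<le> \<rho>" "C * r powr \<alpha> \<le> 1 / 2"
      "\<bar>lam1\<bar> + 2 * M * r powr \<alpha> < \<bar>lam2\<bar> powr (1 + \<alpha>)"
      using r by linarith+
  qed (fact assms r(1) M f \<rho>1 \<rho>3 C_def)+
  then show ?thesis by (rule planar_contraction.local_linearization)
qed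

end
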